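(* Let $X,Y$ be compact metric spaces, $\mu\in\mathcal{P}(X)$, $c\in\mathcal{C}(X\times Y)$, and let $\nu\mapsto\mathcal{V}[\nu]$, with domain $\mathcal{D}\subset\mathcal{P}(Y)$, be either regular or of congestion type, as described in the context. Suppose that $\nu\mapsto\mathcal{V}[\nu]$ is strictly monotone, in the sense that for every $\nu_1,\nu_2\in\mathcal{D}$ one has $$\int_Y(\mathcal{V}[\nu_1]-\mathcal{V}[\nu_2])\,\mathrm{d}(\nu_1-\nu_2)\ge 0,$$ and the inequality is strict whenever $\nu_1\neq\nu_2$. Then all Cournot-Nash equilibria have the same second marginal; that is, if $\gamma_1$ and $\gamma_2$ are Cournot-Nash equilibria, then their marginals on $Y$ coincide.
   Context: $\mathcal{P}(Z)$ denotes the set of Borel probability measures on $Z$, and $\mathcal{C}(Z)$ the continuous real functions on $Z$. The total cost for an agent of type $x\in X$ choosing action $y\in Y$ when the action distribution is $\nu$ is $c(x,y)+\mathcal{V}[\nu](y)$. Two cases are considered. (1) Regular case: $\mathcal{V}[\nu]\in\mathcal{C}(Y)$ for every $\nu\in\mathcal{P}(Y)$, and $\nu\mapsto\mathcal{V}[\nu]$ is continuous from $\mathcal{P}(Y)$ with the weak-$*$ topology to $(\mathcal{C}(Y),\|\cdot\|_\infty)$. Here $\mathcal{D}:=\mathcal{P}(Y)$. (2) Congestion case: a reference Borel measure $m_0$ on $Y$ is fixed; for a probability measure $\nu$ absolutely continuous with respect to $m_0$, $\nu(y)$ denotes its Radon-Nikodym density with respect to $m_0$ at $y$ (written $\nu\in\mathcal{P}(Y)\cap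 L^1(m_0)$). Then $$\mathcal{V}[\nu](y)=f(y,\nu(y))+\mathcal{I}[\nu](y),$$ where $f:Y\times[0,\infty)\to\mathbb{R}\cup\{-\infty\}$ is measurable and non-decreasing in its second argument, $\mathcal{I}[\nu]\in\mathcal{C}(Y)$ for every $\nu\in\mathcal{P}(Y)$, and $\nu\mapsto\mathcal{I}[\nu]$ is continuous from $\mathcal{P}(Y)$ with the weak-$*$ topology to $(\mathcal{C}(Y),\|\cdot\|_\infty)$. Here $$\mathcal{D}:=\Big\{\nu\in\mathcal{P}(Y)\cap L^1(m_0):\ \int_Y f(y,\nu(y))\,\nu(y)\,\mathrm{d}m_0(y)<+\infty\Big\}$$ (the integral being well defined). In case (2) the integral in the monotonicity hypothesis is $\int_Y(\mathcal{V}[\nu_1]-\mathcal{V}[\nu_2])(y)\,(\nu_1(y)-\nu_2(y))\,\mathrm{d}m_0(y)$, with integrand equal to $0$ where $\nu_1(y)=\nu_2(y)$; it is part of the hypothesis that these integrals are well defined (possibly $+\infty$). A Cournot-Nash equilibrium is a $\gamma\in\mathcal{P}(X\times Y)$ whose first marginal is $\mu$, whose second marginal $\nu$ belongs to $\mathcal{D}$, and for which there exists $\varphi\in\mathcal{C}(X)$ such that $c(x,y)+\mathcal{V}[\nu](y)\ge\varphi(x)$ for all $x\in X$ and $m_0$-a.e. $y\in Y$ (in the regular case: for all $x\in X$ and all $y\in Y$), and $c(x,y)+\mathcal{V}[\nu](y)=\varphi(x)$ for $\gamma$-a.e. $(x,y)\in X\times Y$. *)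

theory Defs
  imports "HOL-Probability.Probability"
begin

definition borel_probs :: "'a::topological_space measure set" where
  "borel_probs = {\<nu>. prob_space \<nu> \<and> sets \<nu> = sets borel}"

text \<open>
  The spaces are meant to be compact, so \<open>'y \<Rightarrow>\<^sub>C real\<close> (bounded continuous functions with the supremum distance) is
  \<open>C(Y)\<close> with the sup norm, and \<open>Bcontfun\<close> injects continuous functions into it.
  The weak-* topology is the coarsest one on the Borel probability measures for which
  \<open>\<nu> \<mapsto> \<integral> g d\<nu>\<close> is continuous for each \<open>g \<in> C(Y)\<close>.
\<close>

definition weak_star :: "'y::metric_space measure topology" where
  "weak_star = topology_generated_by
     {{\<nu> \<in> borel_probs. (\<integral>y. apply_bcontfun g y \<partial>\<nu>) \<in> U} | (g :: 'y \<Rightarrow>\<^sub>C real) U. open U}"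

text \<open>
  Integrals of extended-real functions: \<open>e2ennreal\<close> truncates negative values to \<open>0\<close>, so the two
  terms are the integrals of the positive and of the negative part. The difference is meaningful
  only if they are not both infinite, which is the content of \<open>ereal_integral_exists\<close>.
\<close>

definition ereal_integral_exists :: "'a measure \<Rightarrow> ('a \<Rightarrow> ereal) \<Rightarrow> bool" where
  "ereal_integral_exists M g \<longleftrightarrow> g \<in> borel_measurable M \<and>
     ((\<integral>\<^sup>+x. e2ennreal (g x) \<partial>M) \<noteq> \<infinity> \<or> (\<integral>\<^sup>+x. e2ennreal (- g x) \<partial>M) \<noteq> \<infinity>)"

definition ereal_integral :: "'a measure \<Rightarrow> ('a \<Rightarrow> ereal) \<Rightarrow> ereal" where
  "ereal_integral M g =
     enn2ereal (\<integral>\<^sup>+x. e2ennreal (g x) \<partial>M) - enn2ereal (\<integral>\<^sup>+x. e2ennreal (- g x) \<partial>M)"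

text \<open>
  The set \<open>P(Y) \<inter> L\<^sup>1(m0)\<close>. No finiteness of \<open>m0\<close> is imposed; for sigma-finite \<open>m0\<close> having a
  density is the same as absolute continuity. The total mass being 1, the density is integrable
  and finite almost everywhere.
\<close>

definition probs_with_density :: "'y::topological_space measure \<Rightarrow> 'y measure set" where
  "probs_with_density m0 =
     {\<nu> \<in> borel_probs. absolutely_continuous m0 \<nu> \<and> density m0 (RN_deriv m0 \<nu>) = \<nu>}"

definition dens :: "'y measure \<Rightarrow> 'y measure \<Rightarrow> 'y \<Rightarrow> real" where
  "dens m0 \<nu> y = enn2real (RN_deriv m0 \<nu> y)"

text \<open>
  The map \<open>\<nu> \<mapsto> V[\<nu>]\<close>: regular, given by \<open>V\<close> itself, or of congestion type, given by the
  reference measure \<open>m0\<close>, the local term \<open>f\<close> and the nonlocal term \<open>I\<close>.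
  Values at arguments outside \<open>borel_probs\<close>, and of \<open>f\<close> at negative reals, play no role.
\<close>

datatype 'y externality =
    Regular "'y measure \<Rightarrow> 'y \<Rightarrow> real"
  | Congestion "'y measure" "'y \<Rightarrow> real \<Rightarrow> ereal" "'y measure \<Rightarrow> 'y \<Rightarrow> real"

definition regular_map :: "('y::metric_space measure \<Rightarrow> 'y \<Rightarrow> real) \<Rightarrow> bool" where
  "regular_map V \<longleftrightarrow>
     (\<forall>\<nu>\<in>borel_probs. continuous_on UNIV (V \<nu>)) \<and>
     continuous_map weak_star euclidean (\<lambda>\<nu>. Bcontfun (V \<nu>))"

fun admissible :: "'y::metric_space externality \<Rightarrow> bool" where
  "admissible (Regular V) \<longleftrightarrow> regular_map V"
| "admissible (Congestion m0 f I) \<longleftrightarrow>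
     sets m0 = sets borel \<and>
     (\<lambda>(y, t). f y t) \<in> borel_measurable (borel \<Otimes>\<^sub>M restrict_space borel {0..}) \<and>
     (\<forall>y. \<forall>t\<ge>0. f y t \<noteq> \<infinity>) \<and>
     (\<forall>y. mono_on {0..} (f y)) \<and>
     regular_map I"

fun ext_cost :: "'y::metric_space externality \<Rightarrow> 'y measure \<Rightarrow> 'y \<Rightarrow> ereal" where
  "ext_cost (Regular V) \<nu> y = ereal (V \<nu> y)"
| "ext_cost (Congestion m0 f I) \<nu> y = f y (dens m0 \<nu> y) + ereal (I \<nu> y)"

text \<open>In the domain integral, \<open>-\<infinity> * 0 = 0\<close> where the density vanishes.\<close>

fun cost_domain :: "'y::metric_space externality \<Rightarrow> 'y measure set" where
  "cost_domain (Regular V) = borel_probs"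
| "cost_domain (Congestion m0 f I) =
     {\<nu> \<in> probs_with_density m0.
        ereal_integral_exists m0 (\<lambda>y. f y (dens m0 \<nu> y) * ereal (dens m0 \<nu> y)) \<and>
        ereal_integral m0 (\<lambda>y. f y (dens m0 \<nu> y) * ereal (dens m0 \<nu> y)) < \<infinity>}"

definition mono_integrand ::
  "('y \<Rightarrow> ereal) \<Rightarrow> ('y \<Rightarrow> ereal) \<Rightarrow> ('y \<Rightarrow> real) \<Rightarrow> ('y \<Rightarrow> real) \<Rightarrow> 'y \<Rightarrow> ereal" where
  "mono_integrand v1 v2 h1 h2 y =
     (if h1 y = h2 y then 0 else (v1 y - v2 y) * ereal (h1 y - h2 y))"

fun mono_integral :: "'y::metric_space externality \<Rightarrow> 'y measure \<Rightarrow> 'y measure \<Rightarrow> ereal" where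
  "mono_integral (Regular V) \<nu>1 \<nu>2 =
     ereal ((\<integral>y. V \<nu>1 y - V \<nu>2 y \<partial>\<nu>1)
          - (\<integral>y. V \<nu>1 y - V \<nu>2 y \<partial>\<nu>2))"
| "mono_integral (Congestion m0 f I) \<nu>1 \<nu>2 =
     ereal_integral m0
       (mono_integrand (ext_cost (Congestion m0 f I) \<nu>1) (ext_cost (Congestion m0 f I) \<nu>2)
          (dens m0 \<nu>1) (dens m0 \<nu>2))"

text \<open>
  Well-definedness includes that almost nowhere does the integrand contain the undefined
  difference of \<open>-\<infinity>\<close> and \<open>-\<infinity>\<close>, to which \<open>ereal\<close> subtraction would assign the value \<open>\<infinity>\<close>.
\<close>

fun mono_integral_exists :: "'y::metric_space externality \<Rightarrow> 'y measure \<Rightarrow> 'y measure \<Rightarrow> bool" where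
  "mono_integral_exists (Regular V) \<nu>1 \<nu>2 \<longleftrightarrow> True"
| "mono_integral_exists (Congestion m0 f I) \<nu>1 \<nu>2 \<longleftrightarrow>
     (AE y in m0. dens m0 \<nu>1 y \<noteq> dens m0 \<nu>2 y \<longrightarrow>
        \<not> (ext_cost (Congestion m0 f I) \<nu>1 y = -\<infinity> \<and> ext_cost (Congestion m0 f I) \<nu>2 y = -\<infinity>)) \<and>
     ereal_integral_exists m0
       (mono_integrand (ext_cost (Congestion m0 f I) \<nu>1) (ext_cost (Congestion m0 f I) \<nu>2)
          (dens m0 \<nu>1) (dens m0 \<nu>2))"

definition strictly_monotone :: "'y::metric_space externality \<Rightarrow> bool" where
  "strictly_monotone E \<longleftrightarrow>
     (\<forall>\<nu>1\<in>cost_domain E. \<forall>\<nu>2\<in>cost_domain E.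
        mono_integral_exists E \<nu>1 \<nu>2 \<and>
        mono_integral E \<nu>1 \<nu>2 \<ge> 0 \<and>
        (\<nu>1 \<noteq> \<nu>2 \<longrightarrow> mono_integral E \<nu>1 \<nu>2 > 0))"

fun for_actions :: "'y externality \<Rightarrow> ('y::metric_space \<Rightarrow> bool) \<Rightarrow> bool" where
  "for_actions (Regular V) P \<longleftrightarrow> (\<forall>y. P y)"
| "for_actions (Congestion m0 f I) P \<longleftrightarrow> (AE y in m0. P y)"

definition cournot_nash ::
  "'x::metric_space measure \<Rightarrow> ('x \<times> 'y \<Rightarrow> real) \<Rightarrow> 'y::metric_space externality
    \<Rightarrow> ('x \<times> 'y) measure \<Rightarrow> bool" where
  "cournot_nash \<mu> c E \<gamma> \<longleftrightarrow>
     \<gamma> \<in> borel_probs \<and> distr \<gamma> borel fst = \<mu> \<and> distr \<gamma> borel snd \<in> cost_domain E \<and>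
     (\<exists>\<phi> :: 'x \<Rightarrow> real. continuous_on UNIV \<phi> \<and>
        (\<forall>x. for_actions E
           (\<lambda>y. ereal (c (x, y)) + ext_cost E (distr \<gamma> borel snd) y \<ge> ereal (\<phi> x))) \<and>
        (AE (x, y) in \<gamma>.
           ereal (c (x, y)) + ext_cost E (distr \<gamma> borel snd) y = ereal (\<phi> x)))"

end

(*
  Integrating c + V[\<nu>1] \<ge> \<phi>1 against \<gamma>2 and using equality \<gamma>1-a.e. gives
  \<integral> V[\<nu>1] d(\<nu>1 - \<nu>2) \<le> \<integral> c d(\<gamma>2 - \<gamma>1), because both first marginals are \<mu>. Adding the symmetric
  inequality cancels c and contradicts strict monotonicity unless \<nu>1 = \<nu>2.

  In the congestion case one has to see that these integrals are finite. V[\<nu>i] is bounded below m0-a.e.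
  by the inequality at a single x, and bounded above \<nu>i-a.e. by the equality. Where \<nu>1 vanishes
  but \<nu>2 does not, monotonicity of f gives f(y,0) \<le> f(y,\<nu>2(y)), so V[\<nu>1] is bounded above there
  too. Hence both costs may be replaced by bounded real functions off the set where both densities vanish.
*)
theory Submission imports Defs begin

section \<open>Compactness: boundedness, integrability and separability\<close>

lemma bounded_range_continuous_on_compact:
  fixes g :: "'a::topological_space \<Rightarrow> 'b::metric_space"
  assumes "compact (UNIV :: 'a set)" "continuous_on UNIV g"
  shows "bounded (range g)"
  using compact_continuous_image[OF assms(2,1)] by (rule compact_imp_bounded)

lemma integrable_bounded_borel:
  fixes g :: "'a::topological_space \<Rightarrow> real"
  assumes "finite_measure M" "sets M = sets borel" "g \<in> borel_measurable borel" "bounded (range g)"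
  shows "integrable M g"
proof -
  obtain B where "\<And>x. norm (g x) \<le> B"
    using assms(4) by (auto simp: bounded_iff)
  then show ?thesis
    using assms by (intro finite_measure.integrable_const_bound[where B=B])
      (auto cong: measurable_cong_sets)
qed

text \<open>Total boundedness provides a finite net at each scale \<open>inverse (Suc n)\<close>;
  the union of these nets is countable and dense.\<close>

lemma compact_imp_countable_dense:
  assumes "compact (UNIV :: 'a::metric_space set)"
  shows "\<exists>D :: 'a set. countable D \<and> closure D = UNIV"
proof -
  have "\<forall>n. \<exists>k. finite k \<and> (UNIV :: 'a set) \<subseteq> (\<Union>x\<in>k. ball x (inverse (Suc n)))"
    using assms unfolding compact_eq_totally_bounded by (metis inverse_positive_iff_positive of_nat_0_less_iff zero_less_Suc)
  then obtain k where k: "\<And>n. finite (k n)" "\<And>n. (UNIV :: 'a set) \<subseteq> (\<Union>x\<in>k n. ball x (inverse (Suc n)))"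
    by metis
  have "x \<in> closure (\<Union>n. k n)" for x
    unfolding closure_approachable
  proof (intro allI impI)
    fix e :: real assume "0 < e"
    then obtain n where n: "inverse (Suc n) < e"
      using reals_Archimedean by blast
    obtain y where "y \<in> k n" "dist y x < inverse (Suc n)"
      using k(2)[of n] by (auto simp: subset_eq)
    with n show "\<exists>y\<in>\<Union>n. k n. dist y x < e"
      by (intro bexI[of _ y]) auto
  qed
  moreover have "countable (\<Union>n. k n)"
    using k(1) by (intro countable_UN) (auto intro: countable_finite)
  ultimately show ?thesis by blast
qed

text \<open>In the hypothesis the exceptional null set may depend on \<open>x\<close>. A countable
  dense set of types costs only one null set, and continuity in \<open>x\<close> carries the
  inequality over to the remaining types. The uniform version is what makes it possible to evaluate
  the inequality along a measure on the product, where \<open>x\<close> and \<open>y\<close> vary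
  together.\<close>

lemma AE_all_continuous_le:
  fixes c :: "'x::metric_space \<times> 'y::metric_space \<Rightarrow> real" and V :: "'y \<Rightarrow> ereal"
  assumes "compact (UNIV :: 'x set)" and c: "continuous_on UNIV c" and \<phi>: "continuous_on UNIV \<phi>"
    and le: "\<And>x. AE y in M. ereal (\<phi> x) \<le> ereal (c (x, y)) + V y"
  shows "AE y in M. \<forall>x. ereal (\<phi> x) \<le> ereal (c (x, y)) + V y"
proof -
  obtain D :: "'x set" where D: "countable D" "closure D = UNIV"
    using compact_imp_countable_dense[OF assms(1)] by blast
  have "AE y in M. \<forall>x\<in>D. ereal (\<phi> x) \<le> ereal (c (x, y)) + V y"
    using D(1) le by (simp add: AE_ball_countable)
  then show ?thesis
  proof eventually_elim
    case (elim y)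
    \<comment> \<open>Isolating \<open>V y\<close>, which is constant in \<open>x\<close> and
      possibly infinite, leaves a continuous real function of \<open>x\<close> on the other side, so
      the set of good types is closed.\<close>
    have eq: "ereal (\<phi> x) \<le> ereal (c (x, y)) + V y \<longleftrightarrow> ereal (\<phi> x - c (x, y)) \<le> V y" for x
      by (cases "V y") auto
    have "continuous_on UNIV (\<lambda>x. c (x, y))"
      by (rule continuous_on_compose2[OF c]) (auto intro!: continuous_intros)
    then have "closed {x. ereal (\<phi> x - c (x, y)) \<le> V y}"
      using \<phi> by (intro closed_Collect_le continuous_intros)
    then have "closure D \<subseteq> {x. ereal (\<phi> x - c (x, y)) \<le> V y}"
      using elim eq by (intro closure_minimal) auto
    then show ?case
      unfolding D(2) eq by auto
  qed
qed

section \<open>Integral inequalities for bounded real costs\<close>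

text \<open>The integral of \<phi> depends on the first marginal only, so it is the same under
  \<gamma>1 and \<gamma>2 and links the integrated equality to the integrated inequality. The
  inequality is asked for only \<gamma>2-a.e., since in the congestion case it does not hold at
  every action.\<close>

lemma potential_inequality:
  fixes \<gamma>1 \<gamma>2 :: "('x::topological_space \<times> 'y::topological_space) measure"
    and c :: "'x \<times> 'y \<Rightarrow> real" and \<phi> :: "'x \<Rightarrow> real" and u :: "'y \<Rightarrow> real"
  assumes \<gamma>: "\<gamma>1 \<in> borel_probs" "\<gamma>2 \<in> borel_probs"
    and marg: "distr \<gamma>1 borel fst = distr \<gamma>2 borel fst"
    and c: "c \<in> borel_measurable borel" "bounded (range c)"
    and \<phi>: "\<phi> \<in> borel_measurable borel" "bounded (range \<phi>)"
    and u: "u \<in> borel_measurable borel" "bounded (range u)"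
    and eq: "AE (x, y) in \<gamma>1. c (x, y) + u y = \<phi> x"
    and le: "AE (x, y) in \<gamma>2. \<phi> x \<le> c (x, y) + u y"
  shows "(\<integral>y. u y \<partial>distr \<gamma>1 borel snd) - (\<integral>y. u y \<partial>distr \<gamma>2 borel snd)
         \<le> (\<integral>z. c z \<partial>\<gamma>2) - (\<integral>z. c z \<partial>\<gamma>1)"
proof -
  have fst_m: "fst \<in> borel_measurable (borel :: ('x \<times> 'y) measure)"
    and snd_m: "snd \<in> borel_measurable (borel :: ('x \<times> 'y) measure)"
    by (auto intro!: borel_measurable_continuous_onI continuous_intros)
  have int: "integrable \<gamma> c" "integrable \<gamma> (\<lambda>z. \<phi> (fst z))" "integrable \<gamma> (\<lambda>z. u (snd z))"
    and pushfst: "(\<integral>x. \<phi> x \<partial>distr \<gamma> borel fst) = (\<integral>z. \<phi> (fst z) \<partial>\<gamma>)"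
    and pushsnd: "(\<integral>y. u y \<partial>distr \<gamma> borel snd) = (\<integral>z. u (snd z) \<partial>\<gamma>)"
    if "\<gamma> \<in> borel_probs" for \<gamma>
  proof -
    have fm: "finite_measure \<gamma>" and s: "sets \<gamma> = sets borel"
      using that by (auto simp: borel_probs_def prob_space_def)
    show "integrable \<gamma> c"
      using fm s c by (rule integrable_bounded_borel)
    have "bounded (range (\<lambda>z::'x \<times> 'y. \<phi> (fst z)))" "bounded (range (\<lambda>z::'x \<times> 'y. u (snd z)))"
      by (auto intro: bounded_subset[OF \<phi>(2)] bounded_subset[OF u(2)])
    then show "integrable \<gamma> (\<lambda>z. \<phi> (fst z))" "integrable \<gamma> (\<lambda>z. u (snd z))"
      using fm s measurable_compose[OF fst_m \<phi>(1)] measurable_compose[OF snd_m u(1)]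
      by (auto intro!: integrable_bounded_borel)
    show "(\<integral>x. \<phi> x \<partial>distr \<gamma> borel fst) = (\<integral>z. \<phi> (fst z) \<partial>\<gamma>)"
      using fst_m \<phi>(1) s by (intro integral_distr) (auto cong: measurable_cong_sets)
    show "(\<integral>y. u y \<partial>distr \<gamma> borel snd) = (\<integral>z. u (snd z) \<partial>\<gamma>)"
      using snd_m u(1) s by (intro integral_distr) (auto cong: measurable_cong_sets)
  qed
  note int1 = int[OF \<gamma>(1)] and int2 = int[OF \<gamma>(2)]
  have "(\<integral>z. c z \<partial>\<gamma>1) + (\<integral>z. u (snd z) \<partial>\<gamma>1) = (\<integral>z. c z + u (snd z) \<partial>\<gamma>1)"
    using int1 by simp
  also have "\<dots> = (\<integral>z. \<phi> (fst z) \<partial>\<gamma>1)"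
    using eq int1 by (intro integral_cong_AE) (auto simp: case_prod_beta)
  also have "\<dots> = (\<integral>z. \<phi> (fst z) \<partial>\<gamma>2)"
    using marg pushfst[OF \<gamma>(1)] pushfst[OF \<gamma>(2)] by simp
  also have "\<dots> \<le> (\<integral>z. c z + u (snd z) \<partial>\<gamma>2)"
    using le int2 by (intro integral_mono_AE) (auto simp: case_prod_beta)
  also have "\<dots> = (\<integral>z. c z \<partial>\<gamma>2) + (\<integral>z. u (snd z) \<partial>\<gamma>2)"
    using int2 by simp
  finally show ?thesis
    unfolding pushsnd[OF \<gamma>(1)] pushsnd[OF \<gamma>(2)] by simp
qed

text \<open>Two uses of \<open>potential_inequality\<close> with exchanged roles have opposite
  right-hand sides, which cancel in the sum. Working with bounded real \<open>u1\<close> and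
  \<open>u2\<close> lets both types of externality share this argument.\<close>

lemma monotone_integral_nonpos:
  fixes \<gamma>1 \<gamma>2 :: "('x::topological_space \<times> 'y::topological_space) measure"
    and c :: "'x \<times> 'y \<Rightarrow> real" and \<phi>1 \<phi>2 :: "'x \<Rightarrow> real" and u1 u2 :: "'y \<Rightarrow> real"
  assumes \<gamma>: "\<gamma>1 \<in> borel_probs" "\<gamma>2 \<in> borel_probs"
    and marg: "distr \<gamma>1 borel fst = distr \<gamma>2 borel fst"
    and c: "c \<in> borel_measurable borel" "bounded (range c)"
    and \<phi>1: "\<phi>1 \<in> borel_measurable borel" "bounded (range \<phi>1)"
    and \<phi>2: "\<phi>2 \<in> borel_measurable borel" "bounded (range \<phi>2)"
    and u1: "u1 \<in> borel_measurable borel" "bounded (range u1)"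
    and u2: "u2 \<in> borel_measurable borel" "bounded (range u2)"
    and "AE (x, y) in \<gamma>1. c (x, y) + u1 y = \<phi>1 x" "AE (x, y) in \<gamma>2. \<phi>1 x \<le> c (x, y) + u1 y"
    and "AE (x, y) in \<gamma>2. c (x, y) + u2 y = \<phi>2 x" "AE (x, y) in \<gamma>1. \<phi>2 x \<le> c (x, y) + u2 y"
  shows "(\<integral>y. u1 y - u2 y \<partial>distr \<gamma>1 borel snd) - (\<integral>y. u1 y - u2 y \<partial>distr \<gamma>2 borel snd) \<le> 0"
proof -
  have snd_m: "snd \<in> borel_measurable (borel :: ('x \<times> 'y) measure)"
    by (auto intro!: borel_measurable_continuous_onI continuous_intros)
  have diff: "(\<integral>y. u1 y - u2 y \<partial>distr \<gamma> borel snd)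
      = (\<integral>y. u1 y \<partial>distr \<gamma> borel snd) - (\<integral>y. u2 y \<partial>distr \<gamma> borel snd)"
    if "\<gamma> \<in> borel_probs" for \<gamma> :: "('x \<times> 'y) measure"
  proof -
    have "prob_space (distr \<gamma> borel snd)"
      using that snd_m by (intro prob_space.prob_space_distr)
        (auto simp: borel_probs_def cong: measurable_cong_sets)
    then have "finite_measure (distr \<gamma> borel snd)"
      by (simp add: prob_space_def)
    then show ?thesis
      using u1 u2 by (intro Bochner_Integration.integral_diff integrable_bounded_borel) auto
  qed
  show ?thesis
    using potential_inequality[OF \<gamma> marg c \<phi>1 u1 assms(14,15)]
      potential_inequality[OF \<gamma>(2,1) marg[symmetric] c \<phi>2 u2 assms(16,17)]
    unfolding diff[OF \<gamma>(1)] diff[OF \<gamma>(2)] by linarith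
qed

section \<open>Extended-real integrals and densities\<close>

text \<open>Positive and negative parts of \<open>g\<close> and \<open>u\<close> agree a.e., and
  integrability of \<open>u\<close> makes both of their integrals finite, so no difference of
  infinities arises.\<close>

lemma ereal_integral_eq_integral:
  assumes "g \<in> borel_measurable M" "integrable M u" "AE x in M. g x = ereal (u x)"
  shows "ereal_integral M g = ereal (integral\<^sup>L M u)"
proof -
  have "(\<integral>\<^sup>+x. e2ennreal (g x) \<partial>M) = (\<integral>\<^sup>+x. ennreal (u x) \<partial>M)"
    "(\<integral>\<^sup>+x. e2ennreal (- g x) \<partial>M) = (\<integral>\<^sup>+x. ennreal (- u x) \<partial>M)"
    using assms(3) by (auto intro!: nn_integral_cong_AE)
  moreover obtain p q where "0 \<le> p" "(\<integral>\<^sup>+x. ennreal (u x) \<partial>M) = ennreal p"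
    "0 \<le> q" "(\<integral>\<^sup>+x. ennreal (- u x) \<partial>M) = ennreal q"
    using assms(2) unfolding real_integrable_def by (metis ennreal_cases infinity_ennreal_def)
  ultimately show ?thesis
    unfolding ereal_integral_def real_lebesgue_integral_def[OF assms(2)]
    by (simp add: enn2ereal_ennreal)
qed

lemma cost_domain_subset: "cost_domain E \<subseteq> borel_probs"
  by (cases E) (auto simp: probs_with_density_def)

lemma measurable_dens [measurable]: "dens m0 \<nu> \<in> borel_measurable m0"
  unfolding dens_def[abs_def] by measurable

lemma dens_nonneg [simp]: "0 \<le> dens m0 \<nu> y"
  by (simp add: dens_def)

text \<open>Passing to real values by \<open>enn2real\<close> turns \<infinity> into 0. Since \<nu>
  has total mass 1, its derivative is infinite only on an \<open>m0\<close>-null set, and nothing is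
  lost.\<close>

lemma probs_with_density_eq_density_dens:
  assumes "\<nu> \<in> probs_with_density m0"
  shows "density m0 (\<lambda>y. ennreal (dens m0 \<nu> y)) = \<nu>"
proof -
  have eq: "density m0 (RN_deriv m0 \<nu>) = \<nu>" and p: "prob_space \<nu>"
    using assms by (auto simp: probs_with_density_def borel_probs_def)
  have "(\<integral>\<^sup>+y. RN_deriv m0 \<nu> y \<partial>m0) = (\<integral>\<^sup>+y. RN_deriv m0 \<nu> y * indicator (space m0) y \<partial>m0)"
    by (intro nn_integral_cong) auto
  also have "\<dots> = emeasure \<nu> (space m0)"
    using emeasure_density[of "RN_deriv m0 \<nu>" m0 "space m0"] by (simp add: eq)
  also have "space m0 = space \<nu>"
    using arg_cong[OF eq, of space] by simp
  also have "emeasure \<nu> (space \<nu>) = 1"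
    using p by (rule prob_space.emeasure_space_1)
  finally have "AE y in m0. RN_deriv m0 \<nu> y \<noteq> \<infinity>"
    by (intro nn_integral_PInf_AE) auto
  then have "AE y in m0. ennreal (dens m0 \<nu> y) = RN_deriv m0 \<nu> y"
    by (auto simp: dens_def less_top)
  then have "density m0 (\<lambda>y. ennreal (dens m0 \<nu> y)) = density m0 (RN_deriv m0 \<nu>)"
    by (intro density_cong) auto
  with eq show ?thesis by simp
qed

text \<open>Upper bounds on costs come from statements under an action marginal, lower bounds from
  statements under \<open>m0\<close>; this translation allows the two to be combined.\<close>

lemma AE_probs_with_density_iff:
  assumes "\<nu> \<in> probs_with_density m0"
  shows "(AE y in \<nu>. P y) \<longleftrightarrow> (AE y in m0. 0 < dens m0 \<nu> y \<longrightarrow> P y)"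
proof -
  have "(AE y in density m0 (\<lambda>y. ennreal (dens m0 \<nu> y)). P y)
      \<longleftrightarrow> (AE y in m0. 0 < ennreal (dens m0 \<nu> y) \<longrightarrow> P y)"
    by (rule AE_density) measurable
  then show ?thesis
    unfolding probs_with_density_eq_density_dens[OF assms] by simp
qed

lemma measurable_ext_cost_Congestion:
  assumes "admissible (Congestion m0 f I)" "\<nu> \<in> borel_probs"
  shows "ext_cost (Congestion m0 f I) \<nu> \<in> borel_measurable borel"
proof -
  have [simp]: "sets m0 = sets borel"
    and f: "(\<lambda>(y, t). f y t) \<in> borel_measurable (borel \<Otimes>\<^sub>M restrict_space borel {0..})"
    and I: "continuous_on UNIV (I \<nu>)"
    using assms by (auto simp: regular_map_def)
  have d: "dens m0 \<nu> \<in> borel_measurable borel"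
    using measurable_dens[of m0 \<nu>] by (simp cong: measurable_cong_sets)
  \<comment> \<open>Nonnegativity of the density matters here: joint measurability of
    \<open>f\<close> is available only for second arguments in \<open>{0..}\<close>.\<close>
  have "(\<lambda>y. (y, dens m0 \<nu> y)) \<in> measurable borel (borel \<Otimes>\<^sub>M restrict_space borel {0..})"
    using d by (intro measurable_Pair measurable_restrict_space2) auto
  from measurable_compose[OF this f]
  have [measurable]: "(\<lambda>y. f y (dens m0 \<nu> y)) \<in> borel_measurable borel"
    by simp
  have [measurable]: "I \<nu> \<in> borel_measurable borel"
    using I by (rule borel_measurable_continuous_onI)
  have "ext_cost (Congestion m0 f I) \<nu> = (\<lambda>y. f y (dens m0 \<nu> y) + ereal (I \<nu> y))"
    by auto
  then show ?thesis
    by simp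
qed

section \<open>Bounds on the cost at an equilibrium\<close>

text \<open>The equality expresses \<open>V\<close> as \<phi> minus \<open>c\<close>, both bounded.
  The resulting bound mentions \<open>y\<close> alone and therefore passes to the second
  marginal.\<close>

lemma equilibrium_cost_upper_bound:
  fixes \<gamma> :: "('x::topological_space \<times> 'y::topological_space) measure" and V :: "'y \<Rightarrow> ereal"
  assumes \<gamma>: "sets \<gamma> = sets borel" and V: "V \<in> borel_measurable borel"
    and bnd: "bounded (range c)" "bounded (range \<phi>)"
    and eq: "AE (x, y) in \<gamma>. ereal (c (x, y)) + V y = ereal (\<phi> x)"
  shows "\<exists>K. AE y in distr \<gamma> borel snd. V y \<le> ereal K"
proof -
  obtain B C where B: "\<And>z. \<bar>c z\<bar> \<le> B" and C: "\<And>x. \<bar>\<phi> x\<bar> \<le> C"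
    using bnd by (auto simp: bounded_iff)
  have "AE z in \<gamma>. V (snd z) \<le> ereal (B + C)"
    using eq
  proof eventually_elim
    case (elim z)
    then show ?case
      using B[of z] C[of "fst z"] by (cases z; cases "V (snd z)") auto
  qed
  moreover have "snd \<in> measurable \<gamma> borel"
    using \<gamma> by (auto intro!: borel_measurable_continuous_onI continuous_intros cong: measurable_cong_sets)
  ultimately have "AE y in distr \<gamma> borel snd. V y \<le> ereal (B + C)"
    using V by (subst AE_distr_iff) auto
  then show ?thesis by blast
qed

lemma cost_lower_bound:
  fixes V :: "'y \<Rightarrow> ereal"
  assumes bnd: "bounded (range c)" and le: "AE y in M. \<forall>x. ereal (\<phi> x) \<le> ereal (c (x, y)) + V y"
  shows "\<exists>K. AE y in M. ereal K \<le> V y"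
proof -
  obtain B where B: "\<And>z. \<bar>c z\<bar> \<le> B"
    using bnd by (auto simp: bounded_iff)
  \<comment> \<open>One arbitrary type is enough, and \<open>'x\<close> is inhabited.\<close>
  fix x
  have "AE y in M. ereal (\<phi> x - B) \<le> V y"
    using le
  proof eventually_elim
    case (elim y)
    then have "ereal (\<phi> x) \<le> ereal (c (x, y)) + V y" ..
    then show ?case
      using B[of "(x, y)"] by (cases "V y") auto
  qed
  then show ?thesis by blast
qed

text \<open>The delicate region is where the first density vanishes and the second is positive.
  There monotonicity gives \<open>f y 0 \<le> f y (dens m0 \<nu>2 y)\<close>, the right-hand side is
  controlled by \<open>K2\<close>, and the nonlocal terms are bounded by compactness.\<close>

lemma congestion_cost_upper_bound:
  assumes adm: "admissible (Congestion m0 f I)"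
    and Y: "compact (UNIV :: 'y::metric_space set)"
    and \<nu>: "\<nu>1 \<in> probs_with_density m0" "\<nu>2 \<in> probs_with_density (m0 :: 'y measure)"
    and K1: "AE y in \<nu>1. ext_cost (Congestion m0 f I) \<nu>1 y \<le> ereal K1"
    and K2: "AE y in \<nu>2. ext_cost (Congestion m0 f I) \<nu>2 y \<le> ereal K2"
  shows "\<exists>K. AE y in m0. 0 < dens m0 \<nu>1 y \<or> 0 < dens m0 \<nu>2 y
           \<longrightarrow> ext_cost (Congestion m0 f I) \<nu>1 y \<le> ereal K"
proof -
  have "bounded (range (I \<nu>))" if "\<nu> \<in> probs_with_density m0" for \<nu>
    using that adm Y by (intro bounded_range_continuous_on_compact)
      (auto simp: regular_map_def probs_with_density_def)
  then obtain B1 B2 where B: "\<And>y. \<bar>I \<nu>1 y\<bar> \<le> B1" "\<And>y. \<bar>I \<nu>2 y\<bar> \<le> B2"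
    using \<nu> by (auto simp: bounded_iff) metis
  have B0: "0 \<le> B1" "0 \<le> B2"
    using B[of undefined] by linarith+
  \<comment> \<open>The constant dominates both \<open>K1\<close>, for positive first density, and
    \<open>K2 + B1 + B2\<close>, for vanishing first density; the absolute values absorb the signs
    of \<open>K1\<close> and \<open>K2\<close>.\<close>
  have "AE y in m0. 0 < dens m0 \<nu>1 y \<or> 0 < dens m0 \<nu>2 y
           \<longrightarrow> ext_cost (Congestion m0 f I) \<nu>1 y \<le> ereal (\<bar>K1\<bar> + \<bar>K2\<bar> + B1 + B2)"
    using K1[unfolded AE_probs_with_density_iff[OF \<nu>(1)]] K2[unfolded AE_probs_with_density_iff[OF \<nu>(2)]]
  proof eventually_elim
    case (elim y)
    show ?case
    proof (cases "0 < dens m0 \<nu>1 y")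
      case True
      with elim have "ext_cost (Congestion m0 f I) \<nu>1 y \<le> ereal K1" by blast
      also have "\<dots> \<le> ereal (\<bar>K1\<bar> + \<bar>K2\<bar> + B1 + B2)"
        using B0 by simp
      finally show ?thesis by blast
    next
      case False
      then have 0: "dens m0 \<nu>1 y = 0"
        by (simp add: less_le)
      show ?thesis
      proof
        assume "0 < dens m0 \<nu>1 y \<or> 0 < dens m0 \<nu>2 y"
        then have pos2: "0 < dens m0 \<nu>2 y"
          using 0 by simp
        with elim have *: "f y (dens m0 \<nu>2 y) + ereal (I \<nu>2 y) \<le> ereal K2"
          by simp
        have "mono_on {0..} (f y)"
          using adm by simp
        then have "f y 0 \<le> f y (dens m0 \<nu>2 y)"
          by (rule mono_onD) (use pos2 in auto)
        with * B(1)[of y] B(2)[of y]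
        show "ext_cost (Congestion m0 f I) \<nu>1 y \<le> ereal (\<bar>K1\<bar> + \<bar>K2\<bar> + B1 + B2)"
          by (cases "f y 0"; cases "f y (dens m0 \<nu>2 y)") (auto simp: 0)
      qed
    qed
  qed
  then show ?thesis by blast
qed

text \<open>Setting the value to 0 wherever \<open>V\<close> leaves the interval from
  \<open>L\<close> to \<open>K\<close> gives a bounded Borel function, and almost everywhere on
  \<open>P\<close> no value is changed. In the application \<open>P\<close> says that one of the two
  densities is positive.\<close>

lemma bounded_real_version:
  fixes V :: "'y::topological_space \<Rightarrow> ereal"
  assumes V: "V \<in> borel_measurable borel"
    and lower: "AE y in M. ereal L \<le> V y" and upper: "AE y in M. P y \<longrightarrow> V y \<le> ereal K"
  shows "\<exists>u :: 'y \<Rightarrow> real. u \<in> borel_measurable borel \<and> bounded (range u)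
           \<and> (AE y in M. P y \<longrightarrow> V y = ereal (u y))"
proof (intro exI conjI)
  let ?u = "\<lambda>y. if ereal L \<le> V y \<and> V y \<le> ereal K then real_of_ereal (V y) else 0"
  show "?u \<in> borel_measurable borel"
    using V by measurable
  have "norm (?u y) \<le> \<bar>L\<bar> + \<bar>K\<bar>" for y
    by (cases "V y") auto
  then show "bounded (range ?u)"
    unfolding bounded_iff by blast
  show "AE y in M. P y \<longrightarrow> V y = ereal (?u y)"
    using lower upper
  proof eventually_elim
    case (elim y)
    then show ?case by (cases "V y") auto
  qed
qed

section \<open>Comparison of two equilibria\<close>

text \<open>Both cases reduce to \<open>monotone_integral_nonpos\<close>. In the regular case
  \<open>V\<close> is itself bounded; in the congestion case bounded real versions replace the
  costs, and the densities convert the integral over \<open>m0\<close> into integrals over the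
  marginals. The assumption \<open>ex\<close> supplies measurability of the integrand.\<close>

lemma cournot_nash_mono_integral_nonpos:
  fixes c :: "'x::metric_space \<times> 'y::metric_space \<Rightarrow> real"
  assumes X: "compact (UNIV :: 'x set)" and Y: "compact (UNIV :: 'y set)"
    and cont: "continuous_on UNIV c" and adm: "admissible E"
    and ex: "mono_integral_exists E (distr \<gamma>1 borel snd) (distr \<gamma>2 borel snd)"
    and cn: "cournot_nash \<mu> c E \<gamma>1" "cournot_nash \<mu> c E \<gamma>2"
  shows "mono_integral E (distr \<gamma>1 borel snd) (distr \<gamma>2 borel snd) \<le> 0"
proof -
  define \<nu>1 \<nu>2 where \<nu>_def: "\<nu>1 = distr \<gamma>1 borel snd" "\<nu>2 = distr \<gamma>2 borel snd"
  obtain \<phi>1 \<phi>2 :: "'x \<Rightarrow> real" where \<phi>: "continuous_on UNIV \<phi>1" "continuous_on UNIV \<phi>2"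
    and le: "\<And>x. for_actions E (\<lambda>y. ereal (\<phi>1 x) \<le> ereal (c (x, y)) + ext_cost E \<nu>1 y)"
      "\<And>x. for_actions E (\<lambda>y. ereal (\<phi>2 x) \<le> ereal (c (x, y)) + ext_cost E \<nu>2 y)"
    and eq: "AE (x, y) in \<gamma>1. ereal (c (x, y)) + ext_cost E \<nu>1 y = ereal (\<phi>1 x)"
      "AE (x, y) in \<gamma>2. ereal (c (x, y)) + ext_cost E \<nu>2 y = ereal (\<phi>2 x)"
    using cn unfolding cournot_nash_def \<nu>_def by blast
  have \<gamma>: "\<gamma>1 \<in> borel_probs" "\<gamma>2 \<in> borel_probs"
    and marg: "distr \<gamma>1 borel fst = distr \<gamma>2 borel fst"
    and dom: "\<nu>1 \<in> cost_domain E" "\<nu>2 \<in> cost_domain E"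
    using cn unfolding cournot_nash_def \<nu>_def by auto
  have \<nu>: "\<nu>1 \<in> borel_probs" "\<nu>2 \<in> borel_probs"
    using dom cost_domain_subset by blast+
  have s\<gamma>: "sets \<gamma>1 = sets borel" "sets \<gamma>2 = sets borel"
    using \<gamma> by (auto simp: borel_probs_def)
  have "compact (UNIV :: ('x \<times> 'y) set)"
    using compact_Times[OF X Y] by simp
  then have c: "c \<in> borel_measurable borel" "bounded (range c)"
    using cont by (auto intro: borel_measurable_continuous_onI bounded_range_continuous_on_compact)
  have \<phi>1: "\<phi>1 \<in> borel_measurable borel" "bounded (range \<phi>1)"
    and \<phi>2: "\<phi>2 \<in> borel_measurable borel" "bounded (range \<phi>2)"
    using \<phi> X by (auto intro: borel_measurable_continuous_onI bounded_range_continuous_on_compact)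
  note nonpos = monotone_integral_nonpos[OF \<gamma> marg c \<phi>1 \<phi>2, folded \<nu>_def]
  show ?thesis
  proof (cases E)
    case (Regular V)
    have "continuous_on UNIV (V \<nu>1)" "continuous_on UNIV (V \<nu>2)"
      using adm \<nu> by (auto simp: Regular regular_map_def)
    then have "V \<nu>1 \<in> borel_measurable borel" "bounded (range (V \<nu>1))"
      "V \<nu>2 \<in> borel_measurable borel" "bounded (range (V \<nu>2))"
      using Y by (auto intro: borel_measurable_continuous_onI bounded_range_continuous_on_compact)
    from nonpos[OF this] show ?thesis
      using le eq by (simp add: Regular flip: \<nu>_def)
  next
    case (Congestion m0 f I)
    define V1 V2 where V_def: "V1 = ext_cost E \<nu>1" "V2 = ext_cost E \<nu>2"
    define h1 h2 where h_def: "h1 = dens m0 \<nu>1" "h2 = dens m0 \<nu>2"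
    have sm0: "sets m0 = sets borel"
      using adm by (simp add: Congestion)
    have d: "\<nu>1 \<in> probs_with_density m0" "\<nu>2 \<in> probs_with_density m0"
      using dom by (auto simp: Congestion)
    have V: "V1 \<in> borel_measurable borel" "V2 \<in> borel_measurable borel"
      using adm \<nu> unfolding V_def Congestion by (auto intro!: measurable_ext_cost_Congestion simp del: ext_cost.simps)
    have le': "AE y in m0. \<forall>x. ereal (\<phi>1 x) \<le> ereal (c (x, y)) + V1 y"
      "AE y in m0. \<forall>x. ereal (\<phi>2 x) \<le> ereal (c (x, y)) + V2 y"
      using le \<phi> by (auto intro!: AE_all_continuous_le[OF X cont] simp: V_def Congestion simp del: ext_cost.simps)
    obtain L1 L2 where L: "AE y in m0. ereal L1 \<le> V1 y" "AE y in m0. ereal L2 \<le> V2 y"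
      using cost_lower_bound[OF c(2) le'(1)] cost_lower_bound[OF c(2) le'(2)] by blast
    obtain K1 K2 where K: "AE y in \<nu>1. V1 y \<le> ereal K1" "AE y in \<nu>2. V2 y \<le> ereal K2"
      using equilibrium_cost_upper_bound[OF s\<gamma>(1) V(1) c(2) \<phi>1(2)]
        equilibrium_cost_upper_bound[OF s\<gamma>(2) V(2) c(2) \<phi>2(2)] eq
      unfolding V_def \<nu>_def by blast
    note upper = congestion_cost_upper_bound[OF adm[unfolded Congestion] Y]
    have "\<exists>K. AE y in m0. 0 < h1 y \<or> 0 < h2 y \<longrightarrow> V1 y \<le> ereal K"
      using upper[OF d K[unfolded V_def Congestion]] unfolding V_def h_def Congestion .
    then obtain K1' where K1': "AE y in m0. 0 < h1 y \<or> 0 < h2 y \<longrightarrow> V1 y \<le> ereal K1'" ..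
    have "\<exists>K. AE y in m0. 0 < h2 y \<or> 0 < h1 y \<longrightarrow> V2 y \<le> ereal K"
      using upper[OF d(2,1) K(2,1)[unfolded V_def Congestion]] unfolding V_def h_def Congestion .
    then obtain K2' where K2': "AE y in m0. 0 < h1 y \<or> 0 < h2 y \<longrightarrow> V2 y \<le> ereal K2'"
      by (simp only: disj_commute) (erule exE)
    obtain u1 where u1: "u1 \<in> borel_measurable borel" "bounded (range u1)"
      and Vu1: "AE y in m0. 0 < h1 y \<or> 0 < h2 y \<longrightarrow> V1 y = ereal (u1 y)"
      using bounded_real_version[OF V(1) L(1) K1'] by blast
    obtain u2 where u2: "u2 \<in> borel_measurable borel" "bounded (range u2)"
      and Vu2: "AE y in m0. 0 < h1 y \<or> 0 < h2 y \<longrightarrow> V2 y = ereal (u2 y)"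
      using bounded_real_version[OF V(2) L(2) K2'] by blast
    have h_nonneg: "0 \<le> h1 y" "0 \<le> h2 y" for y
      by (auto simp: h_def)
    have h_m: "h1 \<in> borel_measurable m0" "h2 \<in> borel_measurable m0"
      unfolding h_def by measurable
    have dens: "density m0 (\<lambda>y. ennreal (h1 y)) = \<nu>1" "density m0 (\<lambda>y. ennreal (h2 y)) = \<nu>2"
      unfolding h_def using d by (auto intro: probs_with_density_eq_density_dens)
    \<comment> \<open>Each marginal charges only the set where its own density is positive, so under
      either of them both costs coincide with their real versions.\<close>
    have good: "AE y in \<nu>. (\<forall>x. ereal (\<phi>1 x) \<le> ereal (c (x, y)) + V1 y)
        \<and> (\<forall>x. ereal (\<phi>2 x) \<le> ereal (c (x, y)) + V2 y) \<and> V1 y = ereal (u1 y) \<and> V2 y = ereal (u2 y)"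
      if "\<nu> = \<nu>1 \<or> \<nu> = \<nu>2" for \<nu>
    proof -
      have "AE y in m0. 0 < dens m0 \<nu> y \<longrightarrow> (\<forall>x. ereal (\<phi>1 x) \<le> ereal (c (x, y)) + V1 y)
          \<and> (\<forall>x. ereal (\<phi>2 x) \<le> ereal (c (x, y)) + V2 y) \<and> V1 y = ereal (u1 y) \<and> V2 y = ereal (u2 y)"
        using Vu1 Vu2 le' by eventually_elim (use that in \<open>auto simp: h_def\<close>)
      moreover have "\<nu> \<in> probs_with_density m0"
        using that d by blast
      ultimately show ?thesis
        by (subst AE_probs_with_density_iff)
    qed
    have snd_m: "snd \<in> measurable \<gamma>1 borel" "snd \<in> measurable \<gamma>2 borel"
      using s\<gamma> by (auto intro!: borel_measurable_continuous_onI continuous_intros cong: measurable_cong_sets)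
    \<comment> \<open>Pulled back along \<open>snd\<close>, the statements hold a.e. under the
      equilibria; the quantifier over all \<open>x\<close> can then be instantiated with the first
      coordinate.\<close>
    note good1 = AE_distrD[OF snd_m(1) good[OF disjI1[OF refl], unfolded \<nu>_def(1)]]
    note good2 = AE_distrD[OF snd_m(2) good[OF disjI2[OF refl], unfolded \<nu>_def(2)]]
    have "AE (x, y) in \<gamma>1. c (x, y) + u1 y = \<phi>1 x" "AE (x, y) in \<gamma>1. \<phi>2 x \<le> c (x, y) + u2 y"
      using eq(1) good1 unfolding V_def[symmetric] by (eventually_elim; force)+
    moreover have "AE (x, y) in \<gamma>2. \<phi>1 x \<le> c (x, y) + u1 y" "AE (x, y) in \<gamma>2. c (x, y) + u2 y = \<phi>2 x"
      using eq(2) good2 unfolding V_def[symmetric] by (eventually_elim; force)+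
    ultimately have *: "(\<integral>y. u1 y - u2 y \<partial>\<nu>1) - (\<integral>y. u1 y - u2 y \<partial>\<nu>2) \<le> 0"
      by (intro nonpos u1 u2)
    have u_m: "(\<lambda>y. u1 y - u2 y) \<in> borel_measurable m0"
      using u1(1) u2(1) sm0 by (auto cong: measurable_cong_sets)
    have "integrable \<nu>1 (\<lambda>y. u1 y - u2 y)" "integrable \<nu>2 (\<lambda>y. u1 y - u2 y)"
      using \<nu> u1 u2 by (auto intro!: Bochner_Integration.integrable_diff integrable_bounded_borel
          simp: borel_probs_def prob_space_def)
    \<comment> \<open>As \<open>m0\<close> may be infinite, boundedness of \<open>u1 - u2\<close>
      does not suffice; integrability is transported from the probability measures through their
      densities.\<close>
    then have int: "integrable m0 (\<lambda>y. h1 y * (u1 y - u2 y))" "integrable m0 (\<lambda>y. h2 y * (u1 y - u2 y))"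
      using u_m h_m h_nonneg unfolding dens[symmetric] by (auto simp: integrable_density)
    have "mono_integral E \<nu>1 \<nu>2 = ereal_integral m0 (mono_integrand V1 V2 h1 h2)"
      by (simp add: Congestion V_def h_def)
    also have "\<dots> = ereal (\<integral>y. h1 y * (u1 y - u2 y) - h2 y * (u1 y - u2 y) \<partial>m0)"
    proof (rule ereal_integral_eq_integral)
      show "mono_integrand V1 V2 h1 h2 \<in> borel_measurable m0"
        using ex unfolding \<nu>_def[symmetric]
        by (simp add: Congestion ereal_integral_exists_def V_def h_def del: ext_cost.simps)
      show "integrable m0 (\<lambda>y. h1 y * (u1 y - u2 y) - h2 y * (u1 y - u2 y))"
        using int by simp
      show "AE y in m0. mono_integrand V1 V2 h1 h2 y = ereal (h1 y * (u1 y - u2 y) - h2 y * (u1 y - u2 y))"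
        using Vu1 Vu2
      proof eventually_elim
        case (elim y)
        show ?case
        \<comment> \<open>Equal densities give 0 by convention, which covers the points where both
          vanish and the costs need not be real. Unequal densities force one to be positive, where
          \<open>u1\<close> and \<open>u2\<close> apply.\<close>
        proof (cases "h1 y = h2 y")
          case False
          then have "0 < h1 y \<or> 0 < h2 y"
            using h_nonneg[of y] by linarith
          with elim False show ?thesis
            by (simp add: mono_integrand_def algebra_simps)
        qed (simp add: mono_integrand_def)
      qed
    qed
    also have "(\<integral>y. h1 y * (u1 y - u2 y) - h2 y * (u1 y - u2 y) \<partial>m0)
        = (\<integral>y. u1 y - u2 y \<partial>\<nu>1) - (\<integral>y. u1 y - u2 y \<partial>\<nu>2)"
      unfolding dens[symmetric] using int u_m h_m h_nonneg by (simp add: integral_density)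
    finally show ?thesis
      using * by (simp flip: \<nu>_def)
  qed
qed

theorem theorem4p1:
  fixes \<mu> :: "'x::metric_space measure"
    and c :: "'x \<times> 'y::metric_space \<Rightarrow> real"
    and E :: "'y externality"
    and \<gamma>1 \<gamma>2 :: "('x \<times> 'y) measure"
  assumes "compact (UNIV :: 'x set)"
    and "compact (UNIV :: 'y set)"
    and "\<mu> \<in> borel_probs"
    and "continuous_on UNIV c"
    and "admissible E"
    and "strictly_monotone E"
    and "cournot_nash \<mu> c E \<gamma>1"
    and "cournot_nash \<mu> c E \<gamma>2"
  shows "distr \<gamma>1 borel snd = distr \<gamma>2 borel snd"
proof (rule ccontr)
  assume "distr \<gamma>1 borel snd \<noteq> distr \<gamma>2 borel snd"
  moreover have "distr \<gamma>1 borel snd \<in> cost_domain E" "distr \<gamma>2 borel snd \<in> cost_domain E"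
    using assms by (auto simp: cournot_nash_def)
  ultimately have "mono_integral_exists E (distr \<gamma>1 borel snd) (distr \<gamma>2 borel snd)"
    "0 < mono_integral E (distr \<gamma>1 borel snd) (distr \<gamma>2 borel snd)"
    using assms(6) by (auto simp: strictly_monotone_def)
  with cournot_nash_mono_integral_nonpos[OF assms(1,2,4,5) _ assms(7,8)] show False
    by force
qed

end
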